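(* Let $f:[0,1]\to[0,1]$ be a continuous map. If $x\in\Omega(f)\setminus\omega(f)$ then there exist an o-extremum $c$ of $f$ and $n>0$ such that $f^nc=x$.
   Context: For $y\in[0,1]$, $\omega(y)$ is the set of limit points of the forward orbit of $y$, $\omega(f)=\bigcup_y\omega(y)$, and $\Omega(f)$ is the set of non-wandering points. A map is degenerate on a set if its image of that set is a single point. A local extremum $c$ of $f$ is called an o-extremum in the following cases (in neither case is it assumed that $c<b$, i.e. the intervals below may lie on either side of $c$): 1) $c$ is an endpoint of an interval $[c,b]$ such that (i) $f|[c,b]$ is degenerate, (ii) $f$ is not degenerate in any neighborhood of each of $c$ and $b$, (iii) $c$ and $b$ are either both local minima or both local maxima; 2) there is no open interval $(c,b)$ such that $f|(c,b)$ is degenerate. *)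

theory Defs
  imports "HOL-Analysis.Analysis"
begin

text \<open>
  A self-map of the unit interval is a function \<^typ>\<open>real \<Rightarrow> real\<close> used only on \<open>{0..1}\<close>.
  Neighbourhoods are taken in the subspace topology of \<open>{0..1}\<close>, also at the points 0 and 1.
\<close>

text \<open>Cluster points of the sequence of iterates (not accumulation points of the orbit as a
  set), so that the limit set of a periodic point is its orbit.\<close>
definition omega_limit :: "(real \<Rightarrow> real) \<Rightarrow> real \<Rightarrow> real set" where
  "omega_limit f y =
     {z. \<exists>r :: nat \<Rightarrow> nat. strict_mono r \<and> (\<lambda>k. (f ^^ r k) y) \<longlonglongrightarrow> z}"

definition omega_set :: "(real \<Rightarrow> real) \<Rightarrow> real set" where
  "omega_set f = (\<Union>y\<in>{0..1}. omega_limit f y)"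

definition nonwandering_set :: "(real \<Rightarrow> real) \<Rightarrow> real set" where
  "nonwandering_set f =
     {x \<in> {0..1}. \<forall>U. openin (top_of_set {0..1}) U \<and> x \<in> U \<longrightarrow>
        (\<exists>n>0. (f ^^ n) ` U \<inter> U \<noteq> {})}"

definition degenerate_on :: "(real \<Rightarrow> real) \<Rightarrow> real set \<Rightarrow> bool" where
  "degenerate_on f S \<longleftrightarrow> (\<exists>z. f ` S = {z})"

definition locally_nondegenerate :: "(real \<Rightarrow> real) \<Rightarrow> real \<Rightarrow> bool" where
  "locally_nondegenerate f c \<longleftrightarrow>
     (\<forall>U. openin (top_of_set {0..1}) U \<and> c \<in> U \<longrightarrow> \<not> degenerate_on f U)"

definition local_minimum :: "(real \<Rightarrow> real) \<Rightarrow> real \<Rightarrow> bool" where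
  "local_minimum f c \<longleftrightarrow> c \<in> {0..1} \<and>
     (\<exists>U. openin (top_of_set {0..1}) U \<and> c \<in> U \<and> (\<forall>y\<in>U. f c \<le> f y))"

definition local_maximum :: "(real \<Rightarrow> real) \<Rightarrow> real \<Rightarrow> bool" where
  "local_maximum f c \<longleftrightarrow> c \<in> {0..1} \<and>
     (\<exists>U. openin (top_of_set {0..1}) U \<and> c \<in> U \<and> (\<forall>y\<in>U. f y \<le> f c))"

definition local_extremum :: "(real \<Rightarrow> real) \<Rightarrow> real \<Rightarrow> bool" where
  "local_extremum f c \<longleftrightarrow> local_minimum f c \<or> local_maximum f c"

text \<open>Segments serve as the intervals \<open>[c, b]\<close> and \<open>(c, b)\<close> because \<open>b < c\<close> is allowed.\<close>
definition o_extremum :: "(real \<Rightarrow> real) \<Rightarrow> real \<Rightarrow> bool" where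
  "o_extremum f c \<longleftrightarrow> local_extremum f c \<and>
     ((\<exists>b\<in>{0..1}. b \<noteq> c \<and>
          degenerate_on f (closed_segment c b) \<and>
          locally_nondegenerate f c \<and> locally_nondegenerate f b \<and>
          (local_minimum f c \<and> local_minimum f b \<or>
           local_maximum f c \<and> local_maximum f b))
      \<or> \<not> (\<exists>b\<in>{0..1}. b \<noteq> c \<and> degenerate_on f (open_segment c b)))"

end

theory Submission
  imports Defs
begin

text \<open>
  Preimages of \<open>x\<close> under iterates of \<open>f\<close> accumulate at \<open>x\<close>, say from one fixed side.
  If images of one-sided neighbourhoods of \<open>x\<close> always covered neighbourhoods on that same side,
  nested compactness would produce a point whose orbit returns to \<open>x\<close>, so \<open>x \<in> omega_set f\<close>.
  Otherwise choose preimages \<open>y\<^sub>1, y\<^sub>2\<close> with \<open>y\<^sub>2\<close> between \<open>x\<close> and \<open>y\<^sub>1\<close> and with larger time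
  \<open>n\<^sub>2 > n\<^sub>1\<close>: as \<open>x\<close> is not periodic, \<open>f ^^ n\<^sub>2\<close> moves both \<open>x\<close> and \<open>y\<^sub>1\<close> off \<open>x\<close> but stays on
  one side of \<open>x\<close> in between. Such a one-sided contact at \<open>y\<^sub>2\<close> forces the orbit of the segment
  from \<open>x\<close> to \<open>y\<^sub>1\<close> through an o-extremum.
\<close>

section \<open>Sign change and o-extrema at extreme values\<close>

lemma local_minimum_uminus: "local_minimum (\<lambda>y. - f y) c \<longleftrightarrow> local_maximum f c"
  by (simp add: local_minimum_def local_maximum_def)

lemma local_maximum_uminus: "local_maximum (\<lambda>y. - f y) c \<longleftrightarrow> local_minimum f c"
  by (simp add: local_minimum_def local_maximum_def)

lemma degenerate_on_iff:
  "degenerate_on f S \<longleftrightarrow> S \<noteq> {} \<and> (\<exists>z. \<forall>y\<in>S. f y = z)"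
  by (auto simp: degenerate_on_def)

lemma degenerate_on_uminus: "degenerate_on (\<lambda>y. - f y) S \<longleftrightarrow> degenerate_on f S"
  unfolding degenerate_on_iff by (metis minus_minus)

text \<open>The definition treats minima and maxima alike; this carries the result on maxima over to
  minima.\<close>

lemma o_extremum_uminus: "o_extremum (\<lambda>y. - f y) c \<longleftrightarrow> o_extremum f c"
  unfolding o_extremum_def local_extremum_def locally_nondegenerate_def
    local_minimum_uminus local_maximum_uminus degenerate_on_uminus
  by blast

text \<open>The component through \<open>w\<close> of the level set of \<open>f w\<close> is a
  compact interval \<open>{c..b}\<close>, kept strictly inside the segment by the smaller end
  values. Its left end \<open>c\<close> is an o-extremum: of the first kind if \<open>c < b\<close>,
  of the second if the component is a point.\<close>

lemma o_extremum_of_interior_max: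
  fixes f :: "real \<Rightarrow> real"
  assumes cont: "continuous_on {0..1} f"
    and s: "s \<in> {0..1}" and t: "t \<in> {0..1}" and w: "w \<in> closed_segment s t"
    and max: "\<And>y. y \<in> closed_segment s t \<Longrightarrow> f y \<le> f w"
    and "f s < f w" "f t < f w"
  shows "\<exists>c. o_extremum f c \<and> f c = f w"
proof -
  define l where "l = min s t"
  define r where "r = max s t"
  have seg: "closed_segment s t = {l..r}"
    by (auto simp: closed_segment_eq_real_ivl l_def r_def)
  have lr: "0 \<le> l" "r \<le> 1" using s t by (auto simp: l_def r_def)
  have fl: "f l < f w" and fr: "f r < f w" using assms by (auto simp: l_def r_def min_def max_def)
  define P where "P = {y \<in> {l..r}. f y = f w}"
  have wP: "w \<in> P" using w seg by (auto simp: P_def)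
  have contlr: "continuous_on {l..r} f" using cont lr by (auto intro: continuous_on_subset)
  then have clP: "closed P" unfolding P_def
    by (intro continuous_closed_preimage_constant) auto
  define K where "K = connected_component_set P w"
  have KP: "K \<subseteq> P" unfolding K_def by (rule connected_component_subset)
  have "closed K" unfolding K_def by (rule closed_connected_component[OF clP])
  moreover have "bounded K"
    by (rule bounded_subset[of "{l..r}"]) (use KP in \<open>auto simp: P_def\<close>)
  ultimately have "compact K" by (simp add: compact_eq_bounded_closed)
  moreover have "connected K" unfolding K_def by (rule connected_connected_component)
  ultimately obtain c b where K: "K = {c..b}"
    using connected_compact_interval_1 by (metis box_real(2))
  have wK: "w \<in> K" using wP by (simp add: K_def)
  then have cb: "c \<le> b" using K by simp
  have on_K: "l < y \<and> y < r \<and> f y = f w" if "y \<in> {c..b}" for y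
  proof -
    have "y \<in> P" using that KP K by auto
    then show ?thesis using fl fr by (auto simp: P_def less_le)
  qed
  have K_maximal: "T \<subseteq> K" if "connected T" "T \<subseteq> P" "p \<in> T" "p \<in> K" for T p
  proof -
    have "K = connected_component_set P p"
      using that(4) unfolding K_def by (simp add: connected_component_eq)
    then show ?thesis using connected_component_maximal[OF that(3,1,2)] by simp
  qed
  have c: "l < c" "c < r" "f c = f w" and b: "l < b" "b < r" "f b = f w"
    using on_K[of c] on_K[of b] cb by auto
  \<comment> \<open>Were \<open>f\<close> equal to \<open>f w\<close> just left of \<open>c\<close>,
    the interval \<open>{u..c}\<close> would enlarge the component \<open>K\<close>.\<close>
  have left_of_c: "\<exists>y. c - e < y \<and> l < y \<and> y < c \<and> f y \<noteq> f w" if "e > 0" for e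
  proof (rule ccontr)
    assume neg: "\<not> ?thesis"
    define u where "u = max (c - e / 2) ((l + c) / 2)"
    have u: "u < c" "c - e < u" "l < u" using that c by (simp_all add: u_def less_max_iff_disj)
    have "{u..c} \<subseteq> P"
    proof
      fix y assume "y \<in> {u..c}"
      then show "y \<in> P" using neg u c by (cases "y = c") (auto simp: P_def)
    qed
    then have "{u..c} \<subseteq> K" using K_maximal[of "{u..c}" c] u K cb by auto
    then show False using u K by auto
  qed
  have right_of_b: "\<exists>y. y < b + e \<and> y < r \<and> b < y \<and> f y \<noteq> f w" if "e > 0" for e
  proof (rule ccontr)
    assume neg: "\<not> ?thesis"
    define u where "u = min (b + e / 2) ((r + b) / 2)"
    have u: "b < u" "u < b + e" "u < r" using that b by (simp_all add: u_def min_less_iff_disj)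
    have "{b..u} \<subseteq> P"
    proof
      fix y assume "y \<in> {b..u}"
      then show "y \<in> P" using neg u b by (cases "y = b") (auto simp: P_def)
    qed
    then have "{b..u} \<subseteq> K" using K_maximal[of "{b..u}" b] u K cb by auto
    then show False using u K by auto
  qed
  have local_max: "local_maximum f y" if "y \<in> {c..b}" for y
    unfolding local_maximum_def
  proof (intro conjI exI[of _ "{l<..<r}"] ballI)
    show "openin (top_of_set {0..1}) {l<..<r}"
      by (rule open_subset) (use lr in auto)
    show "y \<in> {0..1}" "y \<in> {l<..<r}" using on_K[OF that] lr by auto
    show "f z \<le> f y" if "z \<in> {l<..<r}" for z
      using max[of z] that on_K[OF \<open>y \<in> {c..b}\<close>] seg by auto
  qed
  have ball_in: "\<exists>e>0. \<forall>z\<in>{0..1}. \<bar>z - y\<bar> < e \<longrightarrow> f z = f y"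
    if "openin (top_of_set {0..1}) U" "y \<in> U" "degenerate_on f U" for U y
  proof -
    from that(1,2) obtain e where "e > 0" "ball y e \<inter> {0..1} \<subseteq> U"
      unfolding openin_contains_ball by auto
    then show ?thesis using that(2,3) unfolding degenerate_on_iff
      by (intro exI[of _ e]) (auto simp: dist_real_def abs_minus_commute subset_iff)
  qed
  have nondeg_c: "locally_nondegenerate f c" unfolding locally_nondegenerate_def
  proof (intro allI impI notI, elim conjE)
    fix U assume "openin (top_of_set {0..1}) U" "c \<in> U" "degenerate_on f U"
    from ball_in[OF this] obtain e where "e > 0" "\<forall>z\<in>{0..1}. \<bar>z - c\<bar> < e \<longrightarrow> f z = f c" by auto
    then show False using left_of_c[of e] c lr by force
  qed
  have nondeg_b: "locally_nondegenerate f b" unfolding locally_nondegenerate_def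
  proof (intro allI impI notI, elim conjE)
    fix U assume "openin (top_of_set {0..1}) U" "b \<in> U" "degenerate_on f U"
    from ball_in[OF this] obtain e where "e > 0" "\<forall>z\<in>{0..1}. \<bar>z - b\<bar> < e \<longrightarrow> f z = f b" by auto
    then show False using right_of_b[of e] b lr by force
  qed
  have "o_extremum f c"
  proof (cases "c = b")
    case False
    then have "degenerate_on f (closed_segment c b)"
      using cb on_K by (auto simp: degenerate_on_iff closed_segment_eq_real_ivl)
    then show ?thesis
      unfolding o_extremum_def local_extremum_def
      using False b lr cb nondeg_b nondeg_c local_max[of c] local_max[of b] by force
  next
    case True
    \<comment> \<open>The open segment omits \<open>c\<close>, so continuity identifies the constant
      as \<open>f c = f w\<close>; other values occur arbitrarily close to \<open>c = b\<close> on
      both sides.\<close>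
    have "\<not> degenerate_on f (open_segment c a)" if a: "a \<in> {0..1}" "a \<noteq> c" for a
    proof
      assume "degenerate_on f (open_segment c a)"
      then obtain z where z: "\<And>y. y \<in> open_segment c a \<Longrightarrow> f y = z"
        unfolding degenerate_on_iff by blast
      have "closure (open_segment c a) = closed_segment c a" using a by simp
      moreover have "closed_segment c a \<subseteq> {0..1}"
        using a c lr by (auto simp: closed_segment_eq_real_ivl split: if_splits)
      ultimately have "f c = z"
        using continuous_constant_on_closure[of "open_segment c a" f z c] z cont
        by (metis continuous_on_subset ends_in_segment(1))
      then have const: "f y = f w" if "y \<in> open_segment c a" for y using that z c by simp
      show False
      proof (cases "a < c")
        case True
        then show False using left_of_c[of "c - a"] const
          by (auto simp: open_segment_eq_real_ivl)
      next
        case False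
        then show False using right_of_b[of "a - b"] const a \<open>c = b\<close>
          by (auto simp: open_segment_eq_real_ivl)
      qed
    qed
    then show ?thesis
      unfolding o_extremum_def local_extremum_def using local_max[of c] cb by auto
  qed
  then show ?thesis using c by blast
qed

lemma o_extremum_of_interior_min:
  fixes f :: "real \<Rightarrow> real"
  assumes "continuous_on {0..1} f"
    and "s \<in> {0..1}" "t \<in> {0..1}" "w \<in> closed_segment s t"
    and "\<And>y. y \<in> closed_segment s t \<Longrightarrow> f w \<le> f y"
    and "f w < f s" "f w < f t"
  shows "\<exists>c. o_extremum f c \<and> f c = f w"
  using o_extremum_of_interior_max[of "\<lambda>y. - f y" s t w] assms
  by (auto simp: o_extremum_uminus intro: continuous_on_minus)

section \<open>Iterates and one-sided contact\<close>

lemma funpow_maps_into: "f ` A \<subseteq> A \<Longrightarrow> (f ^^ n) ` A \<subseteq> A"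
  by (induction n) auto

lemma continuous_on_funpow:
  assumes "continuous_on A f" "f ` A \<subseteq> A"
  shows "continuous_on A (f ^^ n)"
proof (induction n)
  case (Suc n)
  have "continuous_on A (f \<circ> (f ^^ n))"
    using Suc funpow_maps_into[OF assms(2), of n] assms(1)
    by (intro continuous_on_compose) (auto intro: continuous_on_subset)
  then show ?case by simp
qed (simp add: id_def)

lemma closed_segment_subset_real:
  fixes u v :: real
  assumes "connected F" "u \<in> F" "v \<in> F"
  shows "closed_segment u v \<subseteq> F"
  using assms by (intro closed_segment_subset) (auto simp flip: is_interval_convex_1 is_interval_connected_1)

text \<open>Induction on \<open>n\<close>: either \<open>f m\<close> still lies strictly between two values of \<open>f\<close> that
  \<open>f ^^ n\<close> does not send to \<open>x\<close>, or the extreme value of \<open>f\<close> beyond \<open>f m\<close> is sent to \<open>x\<close>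
  by \<open>f ^^ n\<close> and is attained at an o-extremum.\<close>

lemma o_extremum_of_one_sided_image:
  fixes f :: "real \<Rightarrow> real"
  assumes cont: "continuous_on {0..1} f" and maps: "f ` {0..1} \<subseteq> {0..1}"
  shows "s \<in> {0..1} \<Longrightarrow> t \<in> {0..1} \<Longrightarrow> m \<in> open_segment s t \<Longrightarrow>
    (f ^^ n) m = x \<Longrightarrow> (f ^^ n) s \<noteq> x \<Longrightarrow> (f ^^ n) t \<noteq> x \<Longrightarrow>
    x \<notin> interior ((f ^^ n) ` closed_segment s t) \<Longrightarrow>
    \<exists>c n. o_extremum f c \<and> n > 0 \<and> (f ^^ n) c = x"
proof (induction n arbitrary: s t m)
  case 0
  \<comment> \<open>With no iteration left, \<open>m = x\<close> is itself an interior point of the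
    segment.\<close>
  have "open_segment s t \<subseteq> interior (closed_segment s t)"
    by (rule interior_maximal) (auto simp: open_segment_eq_real_ivl closed_segment_eq_real_ivl)
  then show ?case using 0 by auto
next
  case (Suc n)
  \<comment> \<open>The first application of \<open>f\<close> is split off, so the induction
    hypothesis can be used on segments inside the interval \<open>F\<close>.\<close>
  note [simp] = funpow_Suc_right and [simp del] = funpow.simps(2)
  define F where "F = f ` closed_segment s t"
  have sub: "closed_segment s t \<subseteq> {0..1}"
    using Suc.prems(1,2) by (auto simp: closed_segment_eq_real_ivl split: if_splits)
  have mseg: "m \<in> closed_segment s t" using Suc.prems(3) by (auto simp: open_segment_def)
  have "connected F" unfolding F_def
    using continuous_on_subset[OF cont sub] by (intro connected_continuous_image) auto
  have in_F: "f s \<in> F" "f t \<in> F" "f m \<in> F" using mseg by (auto simp: F_def)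
  have F01: "F \<subseteq> {0..1}" using sub maps by (auto simp: F_def)
  have img: "(f ^^ Suc n) ` closed_segment s t = (f ^^ n) ` F"
    by (simp only: funpow_Suc_right image_comp F_def)
  \<comment> \<open>A segment with ends in \<open>F\<close> stays in \<open>F\<close>, so its image
    is no larger and \<open>x\<close> remains outside the interior.\<close>
  have between: ?case if "u \<in> F" "v \<in> F" "f m \<in> open_segment u v"
    "(f ^^ n) u \<noteq> x" "(f ^^ n) v \<noteq> x" for u v
  proof (rule Suc.IH[OF _ _ that(3) _ that(4,5)])
    show "u \<in> {0..1}" "v \<in> {0..1}" using that F01 by auto
    show "(f ^^ n) (f m) = x" using Suc.prems(4) by simp
    have "(f ^^ n) ` closed_segment u v \<subseteq> (f ^^ n) ` F"
      by (rule image_mono[OF closed_segment_subset_real[OF \<open>connected F\<close> that(1,2)]])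
    then show "x \<notin> interior ((f ^^ n) ` closed_segment u v)"
      using interior_mono Suc.prems(7) unfolding img by (meson subsetD)
  qed
  have ne: "(f ^^ n) (f s) \<noteq> x" "(f ^^ n) (f t) \<noteq> x" "(f ^^ n) (f m) = x"
    using Suc.prems by simp_all
  then have "f m \<noteq> f s" "f m \<noteq> f t" by auto
  then consider "f m \<in> open_segment (f s) (f t)" | "f s < f m" "f t < f m" | "f m < f s" "f m < f t"
    unfolding open_segment_eq_real_ivl by (cases "f s \<le> f t") force+
  then show ?case
  proof cases
    case 1
    then show ?thesis using between in_F ne by blast
  next
    case 2
    obtain w where w: "w \<in> closed_segment s t" "\<And>y. y \<in> closed_segment s t \<Longrightarrow> f y \<le> f w"
      using continuous_attains_sup[OF _ _ continuous_on_subset[OF cont sub]] by auto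
    have le: "f m \<le> f w" using w mseg by blast
    show ?thesis
    proof (cases "(f ^^ n) (f w) = x")
      case True
      obtain c where "o_extremum f c" "f c = f w"
        using o_extremum_of_interior_max[OF cont Suc.prems(1,2) w] le 2 by auto
      then show ?thesis using True by (intro exI[of _ c] exI[of _ "Suc n"]) simp
    next
      case False
      then have "f m < f w" using le ne by (auto simp: less_le)
      then have "f m \<in> open_segment (f s) (f w)" using 2 by (simp add: open_segment_eq_real_ivl)
      then show ?thesis using between[of "f s" "f w"] in_F ne False w by (auto simp: F_def)
    qed
  next
    case 3
    obtain w where w: "w \<in> closed_segment s t" "\<And>y. y \<in> closed_segment s t \<Longrightarrow> f w \<le> f y"
      using continuous_attains_inf[OF _ _ continuous_on_subset[OF cont sub]] by auto
    have le: "f w \<le> f m" using w mseg by blast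
    show ?thesis
    proof (cases "(f ^^ n) (f w) = x")
      case True
      obtain c where "o_extremum f c" "f c = f w"
        using o_extremum_of_interior_min[OF cont Suc.prems(1,2) w] le 3 by auto
      then show ?thesis using True by (intro exI[of _ c] exI[of _ "Suc n"]) simp
    next
      case False
      then have "f w < f m" using le ne by (auto simp: less_le)
      then have "f m \<in> open_segment (f s) (f w)" using 3 by (simp add: open_segment_eq_real_ivl)
      then show ?thesis using between[of "f s" "f w"] in_F ne False w by (auto simp: F_def)
    qed
  qed
qed

section \<open>Covering chains and omega-limit points\<close>

text \<open>The coverings chain together: pulling points back along the chain and using compactness
  yields one point whose orbit visits, at increasing times, segments that shrink to
  \<open>x\<close>.\<close>

lemma omega_set_of_covering:
  fixes f :: "real \<Rightarrow> real"
  assumes cont: "continuous_on {0..1} f" and maps: "f ` {0..1} \<subseteq> {0..1}"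
    and x: "x \<in> {0..1}" and S: "S \<subseteq> {0..1}" "S \<noteq> {}"
    and shrink: "\<And>y e. y \<in> S \<Longrightarrow> e > 0 \<Longrightarrow>
      \<exists>z\<in>S. closed_segment x z \<subseteq> closed_segment x y \<and> \<bar>z - x\<bar> < e"
    and cover: "\<And>y. y \<in> S \<Longrightarrow>
      \<exists>n>0. \<exists>z\<in>S. closed_segment x z \<subseteq> (f ^^ n) ` closed_segment x y"
  shows "x \<in> omega_set f"
proof -
  \<comment> \<open>Shortening the covered segment by \<open>shrink\<close> keeps the covering and
    forces the lengths to tend to zero.\<close>
  have ex: "\<exists>z. z \<in> S \<and> (\<bar>z - x\<bar> < 1 / real (Suc k) \<and>
      (\<exists>n>0. closed_segment x z \<subseteq> (f ^^ n) ` closed_segment x y))" if "y \<in> S" for y k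
  proof -
    obtain n z where "n > 0" "z \<in> S" "closed_segment x z \<subseteq> (f ^^ n) ` closed_segment x y"
      using cover[OF \<open>y \<in> S\<close>] by blast
    moreover obtain z' where "z' \<in> S" "closed_segment x z' \<subseteq> closed_segment x z"
        "\<bar>z' - x\<bar> < 1 / real (Suc k)"
      using shrink[OF \<open>z \<in> S\<close>, of "1 / real (Suc k)"] by auto
    ultimately show ?thesis by blast
  qed
  obtain y :: "nat \<Rightarrow> real" where y: "\<And>k. y k \<in> S" "\<And>k. \<bar>y (Suc k) - x\<bar> < 1 / real (Suc k)"
      "\<And>k. \<exists>n>0. closed_segment x (y (Suc k)) \<subseteq> (f ^^ n) ` closed_segment x (y k)"
    using dependent_nat_choice[of "\<lambda>_ z. z \<in> S" "\<lambda>k y z. \<bar>z - x\<bar> < 1 / real (Suc k) \<and>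
      (\<exists>n>0. closed_segment x z \<subseteq> (f ^^ n) ` closed_segment x y)", OF _ ex] S
    by (metis (no_types, lifting) ex_in_conv)
  from y(3) obtain n where n: "\<And>k. n k > 0"
      "\<And>k. closed_segment x (y (Suc k)) \<subseteq> (f ^^ n k) ` closed_segment x (y k)"
    by metis
  define J where "J k = closed_segment x (y k)" for k
  define r where "r k = (\<Sum>i<k. n i)" for k
  have J01: "J k \<subseteq> {0..1}" for k
    using x y(1)[of k] S by (auto simp: J_def closed_segment_eq_real_ivl split: if_splits)
  \<comment> \<open>Starting points that follow the itinerary \<open>J 0\<close>, ...,
    \<open>J k\<close>; \<open>r i\<close> is the total time until \<open>J i\<close>, with
    \<open>r 0 = 0\<close>.\<close>
  define A where "A k = {z \<in> J 0. \<forall>i\<le>k. (f ^^ r i) z \<in> J i}" for k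
  have reach: "\<exists>z\<in>A k. (f ^^ r k) z = v" if "v \<in> J k" for v k
    using that
  proof (induction k arbitrary: v)
    case 0
    then show ?case by (auto simp: A_def r_def)
  next
    case (Suc k)
    then obtain u where u: "u \<in> J k" "(f ^^ n k) u = v"
      using n(2)[of k] by (auto simp: J_def)
    then obtain z where z: "z \<in> A k" "(f ^^ r k) z = u" using Suc.IH by blast
    have "r (Suc k) = n k + r k" by (simp add: r_def)
    then have "(f ^^ r (Suc k)) z = v" using z u by (simp add: funpow_add)
    then show ?case using z Suc.prems by (auto simp: A_def le_Suc_eq)
  qed
  have "compact (A k)" for k
  proof -
    have "A k = J 0 \<inter> (\<Inter>i\<in>{..k}. {z \<in> J 0. (f ^^ r i) z \<in> J i})"
      by (auto simp: A_def)
    moreover have "closed {z \<in> J 0. (f ^^ r i) z \<in> J i}" for i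
    proof -
      have "continuous_on (J 0) (f ^^ r i)"
        using continuous_on_subset[OF continuous_on_funpow[OF cont maps] J01] .
      then have "closed (J 0 \<inter> (f ^^ r i) -` J i)"
        by (intro continuous_closed_preimage) (auto simp: J_def)
      moreover have "J 0 \<inter> (f ^^ r i) -` J i = {z \<in> J 0. (f ^^ r i) z \<in> J i}" by auto
      ultimately show ?thesis by simp
    qed
    ultimately show ?thesis by (auto simp: J_def intro!: compact_Int_closed closed_INT)
  qed
  moreover have "A k \<noteq> {}" for k
    using reach[of x k] by (auto simp: J_def)
  moreover have "A k' \<subseteq> A k" if "k \<le> k'" for k k' using that by (auto simp: A_def)
  ultimately have "\<Inter>(range A) \<noteq> {}" by (rule compact_nest)
  then obtain z where z: "\<And>k. z \<in> A k" by auto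
  have "(\<lambda>k. (f ^^ r k) z) \<longlonglongrightarrow> x"
  \<comment> \<open>The bound on \<open>y\<close> starts at index one, hence the shift.\<close>
  proof (rule LIMSEQ_imp_Suc, rule metric_tendsto_imp_tendsto)
    show "(\<lambda>k. 1 / real (Suc k)) \<longlonglongrightarrow> 0" by (rule LIMSEQ_Suc[OF lim_1_over_n])
    have "\<bar>(f ^^ r (Suc k)) z - x\<bar> \<le> 1 / real (Suc k)" for k
    proof -
      have "(f ^^ r (Suc k)) z \<in> J (Suc k)" using z[of "Suc k"] by (auto simp: A_def)
      then show ?thesis using y(2)[of k]
        by (auto simp: J_def closed_segment_eq_real_ivl split: if_splits)
    qed
    then show "\<forall>\<^sub>F k in sequentially. dist ((f ^^ r (Suc k)) z) x \<le> dist (1 / real (Suc k)) 0"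
      by (auto simp: dist_real_def)
  qed
  moreover have "strict_mono r"
    using n(1) by (auto simp: strict_mono_Suc_iff r_def)
  moreover have "z \<in> {0..1}" using z[of 0] J01[of 0] unfolding A_def by blast
  ultimately show ?thesis unfolding omega_set_def omega_limit_def by blast
qed

section \<open>Preimages of a nonwandering point\<close>

text \<open>If \<open>x\<close> had no preimage in a closed neighbourhood \<open>U\<close>, take the component \<open>C\<close> of the orbit
  of \<open>U\<close> that contains \<open>x\<close>, with return map \<open>g\<close>. Then \<open>C = U \<union> g C\<close> with \<open>g C\<close> on one side
  of \<open>x\<close>, so \<open>C\<close> misses at most one point of its closure; but \<open>x \<in> closure (g C)\<close> yields two such
  points \<open>c\<close> and \<open>d\<close>, where \<open>g c = x\<close> and \<open>g d = c\<close>.\<close>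

lemma nonwandering_preimages_accumulate:
  fixes f :: "real \<Rightarrow> real"
  assumes cont: "continuous_on {0..1} f" and maps: "f ` {0..1} \<subseteq> {0..1}"
    and nw: "x \<in> nonwandering_set f" and "d > 0"
  shows "\<exists>n>0. \<exists>y\<in>{0..1}. \<bar>y - x\<bar> \<le> d \<and> (f ^^ n) y = x"
proof (rule ccontr)
  assume neg: "\<not> ?thesis"
  have x: "x \<in> {0..1}" using nw by (simp add: nonwandering_set_def)
  define U where "U = {max 0 (x - d)..min 1 (x + d)}"
  have U: "U = {y \<in> {0..1}. \<bar>y - x\<bar> \<le> d}" by (auto simp: U_def)
  have xU: "x \<in> U" using x \<open>d > 0\<close> by (auto simp: U)
  have miss: "(f ^^ n) y \<noteq> x" if "n > 0" "y \<in> U" for n y using neg that unfolding U by blast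
  define W where "W = (\<Union>n. (f ^^ n) ` U)"
  define C where "C = connected_component_set W x"
  have U01: "U \<subseteq> {0..1}" by (auto simp: U)
  have W01: "W \<subseteq> {0..1}"
    unfolding W_def using funpow_maps_into[OF maps] U01 by fastforce
  have UW: "U \<subseteq> W" unfolding W_def by (auto intro!: exI[of _ 0])
  have CW: "C \<subseteq> W" unfolding C_def by (rule connected_component_subset)
  have UC: "U \<subseteq> C" unfolding C_def
    by (rule connected_component_maximal[OF xU _ UW]) (simp add: U_def)
  have conC: "connected C" unfolding C_def by (rule connected_connected_component)
  have WW: "(f ^^ n) w \<in> W" if w: "w \<in> W" for n w
  proof -
    obtain k u where "u \<in> U" "w = (f ^^ k) u" using w by (auto simp: W_def)
    then have "(f ^^ n) w = (f ^^ (n + k)) u" by (simp add: funpow_add)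
    then show ?thesis using \<open>u \<in> U\<close> unfolding W_def by blast
  qed
  have contn: "continuous_on A (f ^^ n)" if "A \<subseteq> {0..1}" for n A
    using continuous_on_subset[OF continuous_on_funpow[OF cont maps] that] .
  \<comment> \<open>The image is connected and stays in \<open>W\<close>, so a single common point
    with the component \<open>C\<close> traps all of it.\<close>
  have return: "(f ^^ n) ` C \<subseteq> C" if "(f ^^ n) ` C \<inter> C \<noteq> {}" for n
  proof -
    from that obtain p where p: "p \<in> (f ^^ n) ` C" "p \<in> C" by blast
    have "connected ((f ^^ n) ` C)"
      using contn[of C n] CW W01 conC by (intro connected_continuous_image) auto
    moreover have "(f ^^ n) ` C \<subseteq> W" using WW CW by auto
    ultimately have "(f ^^ n) ` C \<subseteq> connected_component_set W p"
      using p(1) by (intro connected_component_maximal)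
    also have "\<dots> = C" using p(2) unfolding C_def by (simp add: connected_component_eq)
    finally show ?thesis .
  qed
  have near: "\<exists>n>0. \<exists>y\<in>U. \<bar>(f ^^ n) y - x\<bar> < e \<and> (f ^^ n) y \<in> U" if "e > 0" for e
  proof -
    \<comment> \<open>The radius \<open>min e d\<close> puts both the point and its return into
      \<open>U\<close>, the return also within \<open>e\<close> of \<open>x\<close>.\<close>
    have "openin (top_of_set {0..1}) ({0..1} \<inter> ball x (min e d))"
      by (rule openin_open_Int) simp
    moreover have "x \<in> {0..1} \<inter> ball x (min e d)" using x that \<open>d > 0\<close> by simp
    ultimately obtain n where "n > 0"
        "(f ^^ n) ` ({0..1} \<inter> ball x (min e d)) \<inter> ({0..1} \<inter> ball x (min e d)) \<noteq> {}"
      using nw unfolding nonwandering_set_def by blast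
    then obtain y where "y \<in> {0..1} \<inter> ball x (min e d)" "(f ^^ n) y \<in> {0..1} \<inter> ball x (min e d)"
      by blast
    then have "y \<in> {0..1}" "\<bar>y - x\<bar> < d" "(f ^^ n) y \<in> {0..1}"
        "\<bar>(f ^^ n) y - x\<bar> < e" "\<bar>(f ^^ n) y - x\<bar> < d"
      by (simp_all add: dist_real_def abs_minus_commute)
    then show ?thesis using \<open>n > 0\<close> by (auto simp: U intro!: exI[of _ n] bexI[of _ y])
  qed
  define N where "N = (LEAST n. n > 0 \<and> (f ^^ n) ` C \<inter> C \<noteq> {})"
  have "\<exists>n. n > 0 \<and> (f ^^ n) ` C \<inter> C \<noteq> {}"
    using near[of 1] UC by fastforce
  then have N: "N > 0" "(f ^^ N) ` C \<inter> C \<noteq> {}"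
    unfolding N_def by (metis (mono_tags, lifting) LeastI)+
  have N_least: "r = 0" if "r < N" "(f ^^ r) ` C \<inter> C \<noteq> {}" for r
    using not_less_Least[of r "\<lambda>n. n > 0 \<and> (f ^^ n) ` C \<inter> C \<noteq> {}"] that
    unfolding N_def by auto
  define g where "g = f ^^ N"
  have gC: "g ` C \<subseteq> C" unfolding g_def by (rule return[OF N(2)])
  have gqC: "(f ^^ (q * N)) ` C \<subseteq> C" for q
    using funpow_maps_into[OF gC, of q] by (simp add: g_def funpow_mult mult.commute)
  \<comment> \<open>Divide \<open>n\<close> by the first return time \<open>N\<close>: full returns
    stay in \<open>C\<close>, so the remainder iterate also meets \<open>C\<close>, and minimality
    makes the remainder zero. The quotient is positive, which leaves one application of
    \<open>g\<close> to perform last.\<close>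
  have into_gC: "(f ^^ n) ` C \<subseteq> g ` C" if "n > 0" "(f ^^ n) ` C \<inter> C \<noteq> {}" for n
  proof -
    have "n = n mod N + (n div N) * N" by simp
    then have "(f ^^ n) ` C = (f ^^ (n mod N)) ` (f ^^ (n div N * N)) ` C"
      by (metis funpow_add image_comp)
    then have "(f ^^ n) ` C \<subseteq> (f ^^ (n mod N)) ` C" using gqC[of "n div N"] by auto
    then have "(f ^^ (n mod N)) ` C \<inter> C \<noteq> {}" using that(2) by blast
    then have "n mod N = 0" using N_least[of "n mod N"] N(1) by simp
    then obtain q where q: "n = Suc q * N" using \<open>n > 0\<close>
      by (metis dvd_div_mult_self gr0_conv_Suc mod_0_imp_dvd mult_is_0 not_gr0)
    then have "(f ^^ n) ` C = g ` (f ^^ (q * N)) ` C"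
      by (simp add: g_def funpow_add image_comp)
    then show ?thesis using gqC[of q] by auto
  qed
  have C_eq: "C \<subseteq> U \<union> g ` C"
  proof
    fix w assume "w \<in> C"
    then obtain k u where k: "u \<in> U" "w = (f ^^ k) u" using CW by (auto simp: W_def)
    show "w \<in> U \<union> g ` C"
    proof (cases "k = 0")
      case False
      then show ?thesis using into_gC[of k] k \<open>w \<in> C\<close> UC by blast
    qed (use k in simp)
  qed
  have x_notin: "x \<notin> g ` C"
  proof
    assume "x \<in> g ` C"
    then obtain k u where "u \<in> U" "x = g ((f ^^ k) u)" using CW by (auto simp: W_def)
    then show False using miss[of "N + k" u] N(1) by (simp add: g_def funpow_add)
  qed
  have x_closure: "x \<in> closure (g ` C)"
    unfolding closure_approachable
  proof (intro allI impI)
    fix e :: real assume "e > 0"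
    then obtain n y where "n > 0" "y \<in> U" "\<bar>(f ^^ n) y - x\<bar> < e" "(f ^^ n) y \<in> U"
      using near by blast
    then show "\<exists>z\<in>g ` C. dist z x < e"
      using into_gC[of n] UC by (intro bexI[of _ "(f ^^ n) y"]) (auto simp: dist_real_def)
  qed
  have clC01: "closure C \<subseteq> {0..1}" using CW W01 by (intro closure_minimal) auto
  have contg: "continuous_on (closure C) g" unfolding g_def by (rule contn[OF clC01])
  \<comment> \<open>By compactness, limits of values of \<open>g\<close> on \<open>C\<close> are
    values of \<open>g\<close> on \<open>closure C\<close>.\<close>
  have "compact (closure C)"
    using bounded_subset[OF _ subset_trans[OF closure_subset clC01]] by simp
  then have "closed (g ` closure C)"
    using contg by (intro compact_imp_closed compact_continuous_image)
  then have cl_gC: "closure (g ` C) \<subseteq> g ` closure C"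
    using closure_subset by (intro closure_minimal image_mono)
  have clC: "closure C \<subseteq> U \<union> closure (g ` C)"
  proof (rule closure_minimal)
    show "C \<subseteq> U \<union> closure (g ` C)" using C_eq closure_subset by blast
    show "closed (U \<union> closure (g ` C))" by (auto simp: U_def)
  qed
  obtain c where c: "c \<in> closure C" "g c = x" using x_closure cl_gC by auto
  then have cC: "c \<notin> C" using x_notin by blast
  \<comment> \<open>Being outside \<open>C\<close>, hence outside \<open>U\<close>, \<open>c\<close>
    is again a limit of values of \<open>g\<close>, and the argument repeats one step back. The
    second missing point is called \<open>b\<close>, since \<open>d\<close> is the radius.\<close>
  then have c_cl: "c \<in> closure (g ` C)" using clC c UC by blast
  then obtain b where b: "b \<in> closure C" "g b = c" using cl_gC by auto
  then have bC: "b \<notin> C" using gC cC by blast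
  then have b_cl: "b \<in> closure (g ` C)" using clC b UC by blast
  have xC: "x \<in> C" using xU UC by blast
  \<comment> \<open>Equality would give \<open>c = g b = g c = x\<close>, a point of
    \<open>C\<close>.\<close>
  have "b \<noteq> c" using b c xC cC by auto
  have "connected (g ` C)"
    using continuous_on_subset[OF contg closure_subset] conC
    by (intro connected_continuous_image)
  have sides: "g ` C \<subseteq> {..x} \<or> g ` C \<subseteq> {x..}"
  proof (rule ccontr)
    assume "\<not> ?thesis"
    then obtain u v where "u \<in> g ` C" "x < u" "v \<in> g ` C" "v < x" by fastforce
    then have "x \<in> {v..u}" "{v..u} \<subseteq> g ` C"
      using connected_contains_Icc[OF \<open>connected (g ` C)\<close>] by auto
    then show False using x_notin by blast
  qed
  \<comment> \<open>\<open>C\<close> contains \<open>x\<close> and comes arbitrarily close to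
    \<open>u\<close>, so by connectedness it contains \<open>v\<close>. Hence of two missing points
    on one side, the one nearer to \<open>x\<close> gives a contradiction.\<close>
  have below: False if "u < v" "v \<le> x" "u \<in> closure C" "v \<notin> C" for u v
  proof -
    from that(1,3) obtain w where "w \<in> C" "dist w u < v - u"
      unfolding closure_approachable by (metis diff_gt_0_iff_gt)
    then have "v \<in> {w..x}" using that by (auto simp: dist_real_def)
    then show False using connected_contains_Icc[OF conC \<open>w \<in> C\<close> xC] that(4) by blast
  qed
  have above: False if "v < u" "x \<le> v" "u \<in> closure C" "v \<notin> C" for u v
  proof -
    from that(1,3) obtain w where "w \<in> C" "dist w u < u - v"
      unfolding closure_approachable by (metis diff_gt_0_iff_gt)
    then have "v \<in> {x..w}" using that by (auto simp: dist_real_def)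
    then show False using connected_contains_Icc[OF conC xC \<open>w \<in> C\<close>] that(4) by blast
  qed
  from sides show False
  proof
    assume "g ` C \<subseteq> {..x}"
    then have "closure (g ` C) \<subseteq> {..x}" by (intro closure_minimal) auto
    then have "b \<le> x" "c \<le> x" using b_cl c_cl by auto
    then show False using below[OF _ _ b(1) cC] below[OF _ _ c(1) bC] \<open>b \<noteq> c\<close>
      by (metis linorder_neqE)
  next
    assume "g ` C \<subseteq> {x..}"
    then have "closure (g ` C) \<subseteq> {x..}" by (intro closure_minimal) auto
    then have "x \<le> b" "x \<le> c" using b_cl c_cl by auto
    then show False using above[OF _ _ b(1) cC] above[OF _ _ c(1) bC] \<open>b \<noteq> c\<close>
      by (metis linorder_neqE)
  qed
qed

section \<open>From one-sided accumulation to an o-extremum\<close>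

lemma o_extremum_of_one_sided_preimages:
  fixes f :: "real \<Rightarrow> real"
  assumes cont: "continuous_on {0..1} f" and maps: "f ` {0..1} \<subseteq> {0..1}"
    and x: "x \<in> {0..1}" and "x \<notin> omega_set f"
    and aperiodic: "\<And>n. n > 0 \<Longrightarrow> (f ^^ n) x \<noteq> x"
    and side: "S = {x<..1} \<or> S = {0..<x}"
    and preimages: "\<And>e. e > 0 \<Longrightarrow> \<exists>n>0. \<exists>y\<in>S. \<bar>y - x\<bar> < e \<and> (f ^^ n) y = x"
  shows "\<exists>c n. o_extremum f c \<and> n > 0 \<and> (f ^^ n) c = x"
proof -
  have S01: "S \<subseteq> {0..1}" using side x by auto
  have in_seg: "z \<in> open_segment x y" if "y \<in> S" "z \<in> S" "\<bar>z - x\<bar> < \<bar>y - x\<bar>" for y z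
    using side that by (auto simp: open_segment_eq_real_ivl)
  have sub_seg: "closed_segment x z \<subseteq> closed_segment x y" if "z \<in> open_segment x y" for y z
    using that by (simp add: subset_closed_segment open_segment_def)
  have shrink: "\<exists>z\<in>S. closed_segment x z \<subseteq> closed_segment x y \<and> \<bar>z - x\<bar> < e"
    if "y \<in> S" "e > 0" for y e
  proof -
    have "min e \<bar>y - x\<bar> > 0" using side that by auto
    then obtain z where "z \<in> S" "\<bar>z - x\<bar> < min e \<bar>y - x\<bar>" using preimages by blast
    then show ?thesis using in_seg[OF that(1)] sub_seg by (intro bexI[of _ z]) auto
  qed
  have "S \<noteq> {}" using preimages[of 1] by auto
  \<comment> \<open>As \<open>x\<close> is not in \<open>omega_set f\<close>, the covering
    hypothesis must fail at some \<open>y0\<close>.\<close>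
  then obtain y0 where y0: "y0 \<in> S"
      "\<And>n z. n > 0 \<Longrightarrow> z \<in> S \<Longrightarrow> \<not> closed_segment x z \<subseteq> (f ^^ n) ` closed_segment x y0"
    using omega_set_of_covering[OF cont maps x S01 _ shrink] \<open>x \<notin> omega_set f\<close> by metis
  have not_interior: "x \<notin> interior ((f ^^ n) ` closed_segment x y0)" if "n > 0" for n
  proof
    assume "x \<in> interior ((f ^^ n) ` closed_segment x y0)"
    then obtain e where e: "e > 0" "ball x e \<subseteq> (f ^^ n) ` closed_segment x y0"
      by (auto simp: mem_interior)
    obtain z where z: "z \<in> S" "\<bar>z - x\<bar> < e" using preimages[OF e(1)] by blast
    then have "closed_segment x z \<subseteq> ball x e"
      by (auto simp: closed_segment_eq_real_ivl dist_real_def split: if_splits)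
    then show False using y0(2)[OF that z(1)] e by blast
  qed
  have y0x: "\<bar>y0 - x\<bar> > 0" using y0(1) side by auto
  obtain n1 y1 where y1: "n1 > 0" "y1 \<in> S" "\<bar>y1 - x\<bar> < \<bar>y0 - x\<bar>" "(f ^^ n1) y1 = x"
    using preimages[OF y0x] by blast
  \<comment> \<open>By aperiodicity and continuity, points close to \<open>x\<close> do not hit
    \<open>x\<close> at times 1 to \<open>n1\<close>; a preimage chosen that close has a time beyond
    \<open>n1\<close>.\<close>
  have "\<forall>\<^sub>F y in at x within {0..1}. \<forall>i\<in>{1..n1}. (f ^^ i) y \<noteq> x"
  proof (rule eventually_ball_finite)
    show "\<forall>i\<in>{1..n1}. \<forall>\<^sub>F y in at x within {0..1}. (f ^^ i) y \<noteq> x"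
    proof
      fix i assume "i \<in> {1..n1}"
      then have "(f ^^ i) x \<noteq> x" using aperiodic by simp
      moreover have "((f ^^ i) \<longlongrightarrow> (f ^^ i) x) (at x within {0..1})"
        using continuous_on_funpow[OF cont maps, of i] x by (simp add: continuous_on_def)
      ultimately show "\<forall>\<^sub>F y in at x within {0..1}. (f ^^ i) y \<noteq> x"
        by (rule tendsto_imp_eventually_ne[rotated])
    qed
  qed simp
  then obtain e where e: "e > 0"
      "\<And>y i. y \<in> {0..1} \<Longrightarrow> y \<noteq> x \<Longrightarrow> \<bar>y - x\<bar> < e \<Longrightarrow> i \<in> {1..n1} \<Longrightarrow> (f ^^ i) y \<noteq> x"
    unfolding eventually_at dist_real_def by blast
  have "min e \<bar>y1 - x\<bar> > 0" using e y1(2) side by auto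
  then obtain n2 y2 where y2: "n2 > 0" "y2 \<in> S" "\<bar>y2 - x\<bar> < e" "\<bar>y2 - x\<bar> < \<bar>y1 - x\<bar>"
      "(f ^^ n2) y2 = x"
    using preimages[of "min e \<bar>y1 - x\<bar>"] by auto
  have "y2 \<noteq> x" using y2(2) side by auto
  then have "n1 < n2" using e(2)[of y2 n2] y2 S01 by (cases "n1 < n2") auto
  \<comment> \<open>The orbit of \<open>y1\<close> is at \<open>x\<close> at time \<open>n1\<close>
    and cannot be there again at time \<open>n2\<close>.\<close>
  have "(f ^^ n2) y1 = (f ^^ (n2 - n1)) ((f ^^ n1) y1)"
    using \<open>n1 < n2\<close> by (metis add.commute funpow_add le_add_diff_inverse less_imp_le o_apply)
  then have "(f ^^ n2) y1 \<noteq> x" using aperiodic[of "n2 - n1"] \<open>n1 < n2\<close> y1(4) by simp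
  moreover have "x \<notin> interior ((f ^^ n2) ` closed_segment x y1)"
    using not_interior[OF y2(1)] interior_mono[OF image_mono[OF sub_seg[OF in_seg[OF y0(1) y1(2,3)]]]]
    by blast
  ultimately show ?thesis
    using o_extremum_of_one_sided_image[OF cont maps x, of y1 y2 n2 x]
      in_seg[OF y1(2) y2(2,4)] y2(1,5) aperiodic[OF y2(1)] y1(2) S01 by blast
qed

theorem corollary7p4:
  fixes f :: "real \<Rightarrow> real" and x :: real
  assumes "continuous_on {0..1} f"
    and "f ` {0..1} \<subseteq> {0..1}"
    and "x \<in> nonwandering_set f - omega_set f"
  shows "\<exists>c n. o_extremum f c \<and> n > 0 \<and> (f ^^ n) c = x"
proof -
  have x: "x \<in> {0..1}" "x \<in> nonwandering_set f" "x \<notin> omega_set f"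
    using assms(3) by (auto simp: nonwandering_set_def)
  \<comment> \<open>A periodic point is a cluster point of its own iterates, along the multiples of
    a period.\<close>
  have aperiodic: "(f ^^ n) x \<noteq> x" if "n > 0" for n
  proof
    assume per: "(f ^^ n) x = x"
    have "(f ^^ (n * k)) x = x" for k
      by (induction k) (simp_all add: funpow_add per)
    moreover have "strict_mono (\<lambda>k. n * k)" using that by (auto simp: strict_mono_def)
    ultimately have "x \<in> omega_limit f x"
      unfolding omega_limit_def by (auto intro!: exI[of _ "\<lambda>k. n * k"])
    then show False using x by (auto simp: omega_set_def)
  qed
  define accumulates where
    "accumulates S \<longleftrightarrow> (\<forall>e>0. \<exists>n>0. \<exists>y\<in>S. \<bar>y - x\<bar> < e \<and> (f ^^ n) y = x)" for S
  have "accumulates {x<..1} \<or> accumulates {0..<x}"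
  proof (rule ccontr)
    assume "\<not> ?thesis"
    then have "\<not> accumulates {x<..1}" "\<not> accumulates {0..<x}" by auto
    then obtain e e' where e: "e > 0" "e' > 0"
        "\<And>n y. n > 0 \<Longrightarrow> y \<in> {x<..1} \<Longrightarrow> \<bar>y - x\<bar> < e \<Longrightarrow> (f ^^ n) y \<noteq> x"
        "\<And>n y. n > 0 \<Longrightarrow> y \<in> {0..<x} \<Longrightarrow> \<bar>y - x\<bar> < e' \<Longrightarrow> (f ^^ n) y \<noteq> x"
      unfolding accumulates_def by metis
    \<comment> \<open>Halving makes the closed bound strict for both sides; the remaining case
      \<open>y = x\<close> is excluded by aperiodicity.\<close>
    from e(1,2) obtain n y where y: "n > 0" "y \<in> {0..1}" "\<bar>y - x\<bar> \<le> min e e' / 2" "(f ^^ n) y = x"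
      using nonwandering_preimages_accumulate[OF assms(1,2) x(2), of "min e e' / 2"] by auto
    have "y \<noteq> x" using aperiodic[OF y(1)] y(4) by auto
    then show False using e(3)[OF y(1), of y] e(4)[OF y(1), of y] y e(1,2)
      by (cases "y < x") (auto simp: min_def split: if_splits)
  qed
  then obtain S where "S = {x<..1} \<or> S = {0..<x}" "accumulates S" by blast
  then show ?thesis
    unfolding accumulates_def
    by (intro o_extremum_of_one_sided_preimages[OF assms(1,2) x(1,3) aperiodic]) blast+
qed

end
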